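(* Let $W$ be an irreducible $T$-module with endpoint $r$ and diameter $d=D-2r$. Then the following hold for $0\le i,j\le d$ and nonzero vectors $u\in E_rW$, $u^*\in E^*_rW$, $u^{\varepsilon}\in E^{\varepsilon}_rW$. (i) $$\langle E_{r+i}u^*,E^*_{r+j}u^{\varepsilon}\rangle=\mathbf{i}^j\,2^{-d}\langle u^*,u^{\varepsilon}\rangle\binom{d}{i}\binom{d}{j}\;{}_2F_1\Big({-i,-j\atop -d};2\Big).$$ (ii) $$\langle E^*_{r+i}u^{\varepsilon},E^{\varepsilon}_{r+j}u\rangle=\mathbf{i}^j\,2^{-d}\langle u^{\varepsilon},u\rangle\binom{d}{i}\binom{d}{j}\;{}_2F_1\Big({-i,-j\atop -d};2\Big).$$ (iii) $$\langle E^{\varepsilon}_{r+i}u,E_{r+j}u^*\rangle=\mathbf{i}^j\,2^{-d}\langle u,u^*\rangle\binom{d}{i}\binom{d}{j}\;{}_2F_1\Big({-i,-j\atop -d};2\Big).$$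
   Context: Let $D$ be a positive integer and let $Q_D$ be the $D$-cube: the graph with vertex set $X=\{0,1\}^D$, two vertices being adjacent iff they differ in exactly one coordinate; $\partial$ denotes path-length distance. $\mathrm{Mat}_X(\mathbb{C})$ is the algebra of complex matrices with rows and columns indexed by $X$, acting on $V=\mathbb{C}^X$ (column vectors) by left multiplication. $V$ carries the Hermitian inner product $\langle v,w\rangle=v^t\overline{w}$ (linear in the first argument). Write $\mathbf{i}^2=-1$ (the bold $\mathbf{i}$ is the imaginary unit; the plain $i$ is an index). Let $A$ be the adjacency matrix of $Q_D$. Fix $x=(0,0,\ldots,0)\in X$. Let $A^*$ be the diagonal matrix in $\mathrm{Mat}_X(\mathbb{C})$ with $(y,y)$-entry $D-2\partial(x,y)$ for $y\in X$, and let $A^{\varepsilon}=-\mathbf{i}(AA^*-A^*A)/2$. Let $T$ be the subalgebra of $\mathrm{Mat}_X(\mathbb{C})$ generated by $A$ and $A^*$. The eigenvalues of $A$ are $\theta_i=D-2i$ $(0\le i\le D)$. For $0\le i\le D$: $E_i=\prod_{0\le j\le D,\,j\ne i}\frac{A-\theta_jI}{\theta_i-\theta_j}$ is the primitive idempotent of $A$ for $\theta_i$ (the orthogonal projection onto the $\theta_i$-eigenspace of $A$); $E_i^*$ is the diagonal matrix with $(y,y)$-entry $1$ if $\partial(x,y)=i$ and $0$ otherwise; and $E_i^{\varepsilon}=P^{-1}E_iP$, where $P=P_1^{\otimes D}$ (Kronecker power, $P_{yz}=\prod_{k=1}^D(P_1)_{y_kz_k}$, invertible) with $P_1=\begin{pmatrix}1&1\\-\mathbf{i}&\mathbf{i}\end{pmatrix}$,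 rows and columns indexed by $0,1$ in that order. ($E_i^*$ and $E_i^{\varepsilon}$ are the primitive idempotents of $A^*$ and $A^{\varepsilon}$ for the eigenvalue $D-2i$.) A $T$-module is a subspace $W\subseteq V$ with $BW\subseteq W$ for all $B\in T$; it is irreducible if $W\ne0$ and it contains no $T$-modules other than $0$ and $W$. The endpoint of an irreducible $T$-module $W$ is $r=\min\{i\mid 0\le i\le D,\ E_i^*W\neq0\}$ (it is known that also $r=\min\{i\mid E_iW\ne0\}$), and its diameter is $d=|\{i\mid 0\le i\le D,\ E_i^*W\ne0\}|-1$; it is known that $d=D-2r$ and $0\le r\le D/2$. For $a\in\mathbb{C}$ and an integer $n\ge0$, $(a)_n=a(a+1)\cdots(a+n-1)$ with $(a)_0=1$. For integers $0\le i,j\le d$, ${}_2F_1\big({-i,-j\atop -d};2\big)=\sum_{n=0}^d\frac{(-i)_n(-j)_n}{(-d)_n\,n!}2^n$. *)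

theory Defs
  imports "HOL-Analysis.Analysis"
begin

text \<open>
  The coordinates of the cube are indexed by a finite type \<open>'n\<close>, so \<open>D = CARD('n)\<close> is an arbitrary
  positive integer; a vertex is a map to \<open>bool\<close>, with \<open>False\<close> and \<open>True\<close> standing for 0 and 1.
\<close>

type_synonym 'n vertex = "'n \<Rightarrow> bool"
type_synonym 'n cvec = "complex ^ ('n \<Rightarrow> bool)"
type_synonym 'n cmat = "complex ^ ('n \<Rightarrow> bool) ^ ('n \<Rightarrow> bool)"

definition cube_adj :: "('n::finite) vertex \<Rightarrow> 'n vertex \<Rightarrow> bool" where
  "cube_adj y z \<longleftrightarrow> card {k. y k \<noteq> z k} = 1"

definition cube_dist :: "('n::finite) vertex \<Rightarrow> 'n vertex \<Rightarrow> nat" where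
  "cube_dist y z = (LEAST m. (cube_adj ^^ m) y z)"

definition base_vertex :: "('n::finite) vertex" where
  "base_vertex = (\<lambda>k. False)"

definition herm :: "('n::finite) cvec \<Rightarrow> 'n cvec \<Rightarrow> complex" where
  "herm v w = (\<Sum>y\<in>UNIV. v $ y * cnj (w $ y))"

text \<open>
  The library's \<open>*s\<close> on this matrix type takes a vector-valued scalar and its \<open>*\<close> is entrywise;
  hence a separate scalar multiplication here and \<open>foldr\<close> over \<open>**\<close> for matrix products below.
\<close>

definition mat_smult :: "complex \<Rightarrow> ('n::finite) cmat \<Rightarrow> 'n cmat" where
  "mat_smult c M = (\<chi> y z. c * M $ y $ z)"

definition adj_mat :: "('n::finite) cmat" where
  "adj_mat = (\<chi> y z. if cube_adj y z then 1 else 0)"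

definition theta :: "'n::finite itself \<Rightarrow> nat \<Rightarrow> complex" where
  "theta _ i = of_nat CARD('n) - 2 * of_nat i"

definition dual_adj_mat :: "('n::finite) cmat" where
  "dual_adj_mat = (\<chi> y z. if y = z then theta TYPE('n) (cube_dist base_vertex y) else 0)"

text \<open>The factors of the product commute, so their order is immaterial.\<close>

definition E_mat :: "nat \<Rightarrow> ('n::finite) cmat" where
  "E_mat i = foldr (**)
     (map (\<lambda>j. mat_smult (1 / (theta TYPE('n) i - theta TYPE('n) j)) (adj_mat - mat (theta TYPE('n) j)))
          (filter (\<lambda>j. j \<noteq> i) [0..<Suc CARD('n)]))
     (mat 1)"

definition E_star :: "nat \<Rightarrow> ('n::finite) cmat" where
  "E_star i = (\<chi> y z. if y = z \<and> cube_dist base_vertex y = i then 1 else 0)"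

definition P1 :: "bool \<Rightarrow> bool \<Rightarrow> complex" where
  "P1 a b = (if \<not> a then 1 else if \<not> b then - \<i> else \<i>)"

definition P_mat :: "('n::finite) cmat" where
  "P_mat = (\<chi> y z. \<Prod>k\<in>UNIV. P1 (y k) (z k))"

definition E_eps :: "nat \<Rightarrow> ('n::finite) cmat" where
  "E_eps i = matrix_inv P_mat ** E_mat i ** P_mat"

definition mat_subalgebra :: "('n::finite) cmat set \<Rightarrow> bool" where
  "mat_subalgebra S \<longleftrightarrow>
     mat 1 \<in> S \<and>
     (\<forall>B\<in>S. \<forall>C\<in>S. B + C \<in> S) \<and>
     (\<forall>c. \<forall>B\<in>S. mat_smult c B \<in> S) \<and>
     (\<forall>B\<in>S. \<forall>C\<in>S. B ** C \<in> S)"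

definition T_alg :: "('n::finite) cmat set" where
  "T_alg = mat_subalgebra hull {adj_mat, dual_adj_mat}"

text \<open>\<open>vec.subspace\<close> is closure under complex scalars (plain \<open>subspace\<close> would be over the reals).\<close>

definition T_module :: "('n::finite) cvec set \<Rightarrow> bool" where
  "T_module W \<longleftrightarrow> vec.subspace W \<and> (\<forall>B\<in>T_alg. \<forall>w\<in>W. B *v w \<in> W)"

definition irreducible_T_module :: "('n::finite) cvec set \<Rightarrow> bool" where
  "irreducible_T_module W \<longleftrightarrow>
     T_module W \<and> W \<noteq> {0} \<and> (\<forall>U. T_module U \<and> U \<subseteq> W \<longrightarrow> U = {0} \<or> U = W)"

definition mod_image :: "('n::finite) cmat \<Rightarrow> 'n cvec set \<Rightarrow> 'n cvec set" where
  "mod_image B W = (\<lambda>w. B *v w) ` W"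

definition module_support :: "('n::finite) cvec set \<Rightarrow> nat set" where
  "module_support W = {i. i \<le> CARD('n) \<and> mod_image (E_star i) W \<noteq> {0}}"

definition module_endpoint :: "('n::finite) cvec set \<Rightarrow> nat" where
  "module_endpoint W = Min (module_support W)"

definition module_diameter :: "('n::finite) cvec set \<Rightarrow> nat" where
  "module_diameter W = card (module_support W) - 1"

text \<open>The hypergeometric sum \<open>2F1(a, b; c; z)\<close> cut off after the term of index \<open>N\<close>.\<close>

definition hyp2F1_upto :: "nat \<Rightarrow> complex \<Rightarrow> complex \<Rightarrow> complex \<Rightarrow> complex \<Rightarrow> complex" where
  "hyp2F1_upto N a b c z =
     (\<Sum>n=0..N. pochhammer a n * pochhammer b n / (pochhammer c n * fact n) * z ^ n)"

end

theory Submission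
  imports Defs
begin

text \<open>
  The generating functions of \<open>E\<^sub>i\<close>, \<open>E\<^sup>*\<^sub>i\<close> and \<open>E\<^sup>\<epsilon>\<^sub>i\<close> (with the variable \<open>s\<close> marking the index) are \<open>D\<close>-th Kronecker
  powers of 2 by 2 matrices of determinant \<open>s\<close>. Vectors in \<open>E\<^sup>*\<^sub>r W\<close>, where \<open>r\<close> is the endpoint of \<open>W\<close>, are
  fixed by Kronecker powers of upper unipotent matrices, so by the LDU decomposition a Kronecker
  power of \<open>M\<close> satisfies \<open>\<langle>M v, w\<rangle> = M\<^sub>1\<^sub>1\<^sup>D\<^sup>-\<^sup>2\<^sup>r (det M)\<^sup>r \<langle>v, w\<rangle>\<close> for such \<open>v\<close> and \<open>w\<close>. This forces \<open>E\<^sup>*\<^sub>r W\<close> to be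
  one-dimensional and \<open>d = D - 2r\<close>; moreover \<open>u\<close> and \<open>u\<^sup>\<epsilon>\<close> are Kronecker powers of explicit matrices applied
  to multiples of \<open>u\<^sup>*\<close>. All three families of inner products then have the generating function
  \<open>2\<^sup>-\<^sup>d ((1 + s) + \<i> t (1 - s))\<^sup>d (s t)\<^sup>r\<close> times the inner product of the two vectors, and its coefficients
  are the Krawtchouk values.
\<close>

subsection \<open>Kronecker powers of 2 by 2 matrices\<close>

text \<open>
  \<open>kpow a b c e\<close> is the \<open>D\<close>-th Kronecker power of the matrix with rows \<open>(a, b)\<close> and \<open>(c, e)\<close>;
  the coordinate value \<open>False\<close> indexes the first row and column.
\<close>

definition entry2 :: "complex \<Rightarrow> complex \<Rightarrow> complex \<Rightarrow> complex \<Rightarrow> bool \<Rightarrow> bool \<Rightarrow> complex" where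
  "entry2 a b c e p q = (if p then if q then e else c else if q then b else a)"

definition kpow :: "complex \<Rightarrow> complex \<Rightarrow> complex \<Rightarrow> complex \<Rightarrow> ('n::finite) cmat" where
  "kpow a b c e = (\<chi> y z. \<Prod>k\<in>UNIV. entry2 a b c e (y k) (z k))"

definition weight :: "('n::finite) vertex \<Rightarrow> nat" where
  "weight y = card {k. y k}"

text \<open>Distributivity over independent coordinates; it lets a matrix product of Kronecker
  powers be computed one coordinate at a time.\<close>

lemma sum_prod_bool_fun:
  fixes f :: "'n::finite \<Rightarrow> bool \<Rightarrow> complex"
  shows "(\<Sum>y\<in>UNIV. \<Prod>k\<in>UNIV. f k (y k)) = (\<Prod>k\<in>UNIV. f k False + f k True)"
proof -
  have "(\<Prod>k\<in>UNIV. \<Sum>p\<in>(UNIV::bool set). f k p) = (\<Sum>y\<in>UNIV. \<Prod>k\<in>UNIV. f k (y k))"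
    by (subst prod_sum_PiE) auto
  then show ?thesis
    by (simp add: UNIV_bool)
qed

text \<open>The mixed-product rule: identities between matrices of size 2^D become identities of 2
  by 2 matrices.\<close>

lemma kpow_mult:
  "(kpow a b c e :: ('n::finite) cmat) ** kpow a' b' c' e' =
     kpow (a * a' + b * c') (a * b' + b * e') (c * a' + e * c') (c * b' + e * e')"
proof -
  have "(\<Sum>x\<in>UNIV. (\<Prod>k\<in>UNIV. entry2 a b c e (y k) (x k)) *
          (\<Prod>k\<in>UNIV. entry2 a' b' c' e' (x k) (z k))) =
        (\<Prod>k\<in>UNIV. entry2 (a * a' + b * c') (a * b' + b * e') (c * a' + e * c')
          (c * b' + e * e') (y k) (z k))" for y z :: "'n vertex"
    unfolding prod.distrib [symmetric]
    by (subst sum_prod_bool_fun) (rule prod.cong, auto simp: entry2_def)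
  then show ?thesis
    by (simp add: kpow_def matrix_matrix_mult_def vec_eq_iff)
qed

lemma kpow_diag_nth:
  "(kpow a 0 0 e :: ('n::finite) cmat) $ y $ z =
     (if y = z then a ^ (CARD('n) - weight y) * e ^ weight y else 0)"
proof (cases "y = z")
  case True
  have "(\<Prod>k\<in>UNIV. entry2 a 0 0 e (y k) (y k)) = (\<Prod>k\<in>UNIV. if y k then e else a)"
    by (rule prod.cong) (auto simp: entry2_def)
  also have "\<dots> = (\<Prod>k\<in>{k. y k}. e) * (\<Prod>k\<in>- {k. y k}. a)"
    by (subst prod.If_cases) (auto simp: Collect_neg_eq)
  also have "\<dots> = a ^ (CARD('n) - weight y) * e ^ weight y"
    by (simp add: weight_def Compl_eq_Diff_UNIV card_Diff_subset)
  finally show ?thesis using True by (simp add: kpow_def)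
next
  case False
  then obtain k where "y k \<noteq> z k" by auto
  then have "(\<Prod>k\<in>UNIV. entry2 a 0 0 e (y k) (z k)) = 0"
    by (intro prod_zero) (auto simp: entry2_def intro!: bexI [of _ k])
  with False show ?thesis by (simp add: kpow_def)
qed

lemma kpow_1: "kpow 1 0 0 1 = mat 1"
  by (simp add: vec_eq_iff kpow_diag_nth mat_def)

lemma P_mat_eq: "P_mat = kpow 1 1 (- \<i>) \<i>"
  by (auto simp: P_mat_def kpow_def vec_eq_iff P1_def entry2_def intro!: prod.cong)

subsection \<open>The idempotents as conjugates of the dual idempotents\<close>

lemma cube_adj_iff:
  "cube_adj y z \<longleftrightarrow> (\<exists>k. z = y(k := \<not> y k))"
proof
  assume "cube_adj y z"
  then obtain k where k: "{k. y k \<noteq> z k} = {k}"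
    by (auto simp: cube_adj_def card_1_singleton_iff)
  have "z = y(k := \<not> y k)"
  proof
    fix l
    show "z l = (y(k := \<not> y k)) l"
      using k by (cases "l = k") (auto simp: set_eq_iff)
  qed
  then show "\<exists>k. z = y(k := \<not> y k)" ..
next
  assume "\<exists>k. z = y(k := \<not> y k)"
  then obtain k where "z = y(k := \<not> y k)" ..
  then have "{k. y k \<noteq> z k} = {k}" by auto
  then show "cube_adj y z" by (simp add: cube_adj_def)
qed

text \<open>A step changes one coordinate, so it raises the weight by at most one; conversely,
  switching on the true coordinates one by one gives a path of length
  \<open>weight y\<close>.\<close>

lemma cube_dist_base: "cube_dist base_vertex y = weight y"
proof -
  have le: "weight z \<le> m" if "(cube_adj ^^ m) base_vertex z" for m and z :: "'a vertex"
    using that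
  proof (induction m arbitrary: z)
    case 0
    then show ?case by (auto simp: base_vertex_def weight_def)
  next
    case (Suc m)
    from Suc.prems obtain x where "(cube_adj ^^ m) base_vertex x" "cube_adj x z"
      by auto
    then obtain k where x: "(cube_adj ^^ m) base_vertex x" "z = x(k := \<not> x k)"
      unfolding cube_adj_iff [of x z] by blast
    have "{l. z l} \<subseteq> insert k {l. x l}"
      using x(2) by (auto split: if_splits)
    then have "weight z \<le> card (insert k {l. x l})"
      unfolding weight_def by (rule card_mono [rotated]) simp
    also have "\<dots> \<le> Suc (weight x)"
      unfolding weight_def by (simp add: card_insert_if)
    finally have "weight z \<le> Suc (weight x)" .
    with Suc.IH [OF x(1)] show ?case by simp
  qed
  have path: "(cube_adj ^^ m) base_vertex z" if "weight z = m" for m and z :: "'a vertex"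
    using that
  proof (induction m arbitrary: z)
    case 0
    then have "{k. z k} = {}" unfolding weight_def by (subst (asm) card_0_eq) auto
    then show ?case by (auto simp: base_vertex_def fun_eq_iff)
  next
    case (Suc m)
    then obtain k where k: "z k"
      by (fastforce simp: weight_def)
    have "{l. (z(k := False)) l} = {l. z l} - {k}" by auto
    then have "weight (z(k := False)) = m"
      using Suc.prems k by (simp add: weight_def)
    then have "(cube_adj ^^ m) base_vertex (z(k := False))" by (rule Suc.IH)
    moreover have "cube_adj (z(k := False)) z"
      using k unfolding cube_adj_iff by (intro exI [of _ k]) (auto simp: fun_eq_iff)
    ultimately show ?case by auto
  qed
  show ?thesis
    unfolding cube_dist_def by (rule Least_equality) (auto intro: path le)
qed

lemma weight_le: "weight (y :: ('n::finite) vertex) \<le> CARD('n)"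
  unfolding weight_def by (rule card_mono) auto

lemma E_star_nth: "E_star i $ y $ z = (if y = z \<and> weight y = i then 1 else 0)"
  by (simp add: E_star_def cube_dist_base)

lemma E_star_vec_nth: "(E_star i *v v) $ y = (if weight y = i then v $ y else 0)"
proof -
  have "(E_star i *v v) $ y = (\<Sum>z\<in>UNIV. if y = z then (if weight y = i then v $ z else 0) else 0)"
    unfolding matrix_vector_mult_def vec_lambda_beta by (rule sum.cong) (auto simp: E_star_nth)
  then show ?thesis by simp
qed

lemma kpow_diag_vec_nth:
  "((kpow a 0 0 e :: ('n::finite) cmat) *v v) $ y = a ^ (CARD('n) - weight y) * e ^ weight y * v $ y"
proof -
  have "((kpow a 0 0 e :: 'n cmat) *v v) $ y =
      (\<Sum>z\<in>UNIV. if y = z then a ^ (CARD('n) - weight y) * e ^ weight y * v $ z else 0)"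
    unfolding matrix_vector_mult_def vec_lambda_beta by (rule sum.cong) (auto simp: kpow_diag_nth)
  then show ?thesis by simp
qed

lemma kpow_diag_eq_sum_E_star:
  "(kpow a 0 0 e :: ('n::finite) cmat) *v v =
     (\<Sum>i\<le>CARD('n). (a ^ (CARD('n) - i) * e ^ i) *s (E_star i *v v))"
proof -
  have "(\<Sum>i\<le>CARD('n). (a ^ (CARD('n) - i) * e ^ i) * (E_star i *v v) $ y) =
        a ^ (CARD('n) - weight y) * e ^ weight y * v $ y" for y
    using weight_le [of y] by (simp add: E_star_vec_nth if_distrib cong: if_cong)
  then show ?thesis
    by (simp add: vec_eq_iff kpow_diag_vec_nth)
qed

text \<open>The columns of the Hadamard matrix \<open>kpow 1 1 1 (-1)\<close> are the characters of
  (Z/2)^D. Flipping coordinate \<open>k\<close> multiplies the character of \<open>z\<close> by a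
  sign, and the D signs add up to the eigenvalue.\<close>

lemma adj_hadamard:
  "(adj_mat :: ('n::finite) cmat) ** kpow 1 1 1 (-1) = kpow 1 1 1 (-1) ** dual_adj_mat"
proof -
  let ?H = "\<lambda>y z. \<Prod>k\<in>UNIV. entry2 1 1 1 (-1) (y k) (z k)"
  have flip: "?H (y(k := \<not> y k)) z = (if z k then -1 else 1) * ?H y z" for k and y z :: "'n vertex"
  proof -
    have "?H (y(k := \<not> y k)) z = entry2 1 1 1 (-1) (\<not> y k) (z k) *
       (\<Prod>l\<in>UNIV - {k}. entry2 1 1 1 (-1) (y l) (z l))"
      by (subst prod.remove [of _ k]) (auto intro!: prod.cong)
    moreover have "?H y z = entry2 1 1 1 (-1) (y k) (z k) *
       (\<Prod>l\<in>UNIV - {k}. entry2 1 1 1 (-1) (y l) (z l))"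
      by (subst prod.remove [of _ k]) auto
    ultimately show ?thesis by (simp add: entry2_def)
  qed
  have signs: "(\<Sum>k\<in>UNIV. if z k then -1 else 1) = theta TYPE('n) (weight z)" for z :: "'n vertex"
  proof -
    have "(\<Sum>k\<in>UNIV. if z k then -1 else (1::complex)) =
        - of_nat (card {k. z k}) + of_nat (card (- {k. z k}))"
      by (subst sum.If_cases) (auto simp: Collect_neg_eq)
    also have "card (- {k. z k}) = CARD('n) - weight z"
      by (simp add: Compl_eq_Diff_UNIV card_Diff_subset weight_def)
    finally show ?thesis
      using weight_le [of z] by (simp add: theta_def of_nat_diff weight_def)
  qed
  have left: "(\<Sum>x\<in>UNIV. (if cube_adj y x then 1 else 0) * ?H x z) =
      ?H y z * theta TYPE('n) (weight z)" for y z :: "'n vertex"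
  proof -
    have inj: "inj (\<lambda>k. y(k := \<not> y k))"
      by (rule injI) (metis fun_upd_apply)
    have img: "{x. cube_adj y x} = range (\<lambda>k. y(k := \<not> y k))"
      by (auto simp: cube_adj_iff)
    have "(\<Sum>x\<in>UNIV. (if cube_adj y x then 1 else 0) * ?H x z) = (\<Sum>x\<in>{x. cube_adj y x}. ?H x z)"
      by (intro sum.mono_neutral_cong_right) auto
    also have "\<dots> = (\<Sum>k\<in>UNIV. ?H (y(k := \<not> y k)) z)"
      unfolding img by (subst sum.reindex [OF inj]) simp
    also have "\<dots> = (\<Sum>k\<in>UNIV. if z k then -1 else 1) * ?H y z"
      unfolding flip by (simp only: sum_distrib_right)
    finally show ?thesis by (simp add: signs)
  qed
  have right: "(\<Sum>x\<in>UNIV. ?H y x * (if x = z then theta TYPE('n) (weight x) else 0)) =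
      ?H y z * theta TYPE('n) (weight z)" for y z :: "'n vertex"
    by (simp add: if_distrib cong: if_cong)
  show ?thesis
    by (simp only: vec_eq_iff adj_mat_def dual_adj_mat_def kpow_def matrix_matrix_mult_def
          cube_dist_base vec_lambda_beta left right simp_thms)
qed

section \<open>Idempotents as Lagrange polynomials in the generators\<close>

lemma theta_eq_iff: "theta TYPE('n::finite) i = theta TYPE('n) j \<longleftrightarrow> i = j"
  by (simp add: theta_def)

lemma mat_smult_mult_left: "mat_smult c A ** B = mat_smult c (A ** B)"
  by (simp add: mat_smult_def matrix_matrix_mult_def vec_eq_iff sum_distrib_left mult.assoc)

lemma mat_smult_mult_right: "A ** mat_smult c B = mat_smult c (A ** B)"
  by (simp add: mat_smult_def matrix_matrix_mult_def vec_eq_iff sum_distrib_left mult.left_commute)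

lemma mat_smult_vec: "mat_smult c A *v v = c *s (A *v v)"
  by (simp add: mat_smult_def matrix_vector_mult_def vec_eq_iff sum_distrib_left mult.assoc)

lemma matrix_diff_mult_left: "((A :: ('n::finite) cmat) - B) ** C = A ** C - B ** C"
  by (simp add: matrix_matrix_mult_def vec_eq_iff left_diff_distrib sum_subtractf)

lemma matrix_diff_mult_right: "(C :: ('n::finite) cmat) ** (A - B) = C ** A - C ** B"
  by (simp add: matrix_matrix_mult_def vec_eq_iff right_diff_distrib sum_subtractf)

lemma mat_mult_nth: "((mat a :: ('n::finite) cmat) ** B) $ y $ z = a * B $ y $ z"
proof -
  have "((mat a :: 'n cmat) ** B) $ y $ z = (\<Sum>x\<in>UNIV. if y = x then a * B $ x $ z else 0)"
    unfolding matrix_matrix_mult_def vec_lambda_beta by (rule sum.cong) (auto simp: mat_def)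
  then show ?thesis by simp
qed

lemma mult_mat_nth: "(B ** (mat a :: ('n::finite) cmat)) $ y $ z = a * B $ y $ z"
proof -
  have "(B ** (mat a :: 'n cmat)) $ y $ z = (\<Sum>x\<in>UNIV. if x = z then a * B $ y $ x else 0)"
    unfolding matrix_matrix_mult_def vec_lambda_beta by (rule sum.cong) (auto simp: mat_def)
  then show ?thesis by simp
qed

text \<open>Diagonal matrices multiply entrywise, so the polynomial is evaluated at each eigenvalue
  separately. Arbitrary \<open>c\<close> and \<open>js\<close> let the induction run.\<close>

lemma lagrange_dual_adj:
  "foldr (**) (map (\<lambda>j. mat_smult (c j) (dual_adj_mat - mat (theta TYPE('n) j))) js) (mat 1) =
     ((\<chi> y z. if y = z then \<Prod>j\<leftarrow>js. c j * (theta TYPE('n) (weight y) - theta TYPE('n) j) else 0)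
       :: ('n::finite) cmat)"
proof (induction js)
  case Nil
  then show ?case by (simp add: mat_def vec_eq_iff)
next
  case (Cons j js)
  have "(\<Sum>x\<in>UNIV. mat_smult (c j) (dual_adj_mat - mat (theta TYPE('n) j)) $ y $ x *
          (if x = z then q x else 0)) =
        (if y = z then c j * (theta TYPE('n) (weight y) - theta TYPE('n) j) * q y else 0)"
    for y z :: "'n vertex" and q
    by (subst sum.mono_neutral_right [of UNIV "{z}"])
      (auto simp: mat_smult_def dual_adj_mat_def mat_def cube_dist_base)
  then show ?case
    unfolding list.map foldr.simps comp_apply Cons.IH
    by (simp add: matrix_matrix_mult_def vec_eq_iff)
qed

text \<open>Intertwining survives shifts by scalars, scaling and products, hence passes from
  \<open>A\<close> and \<open>B\<close> to polynomials in them.\<close>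

lemma intertwine_foldr:
  fixes A B H :: "('n::finite) cmat"
  assumes "A ** H = H ** B"
  shows "foldr (**) (map (\<lambda>j. mat_smult (c j) (A - mat (t j))) js) (mat 1) ** H =
         H ** foldr (**) (map (\<lambda>j. mat_smult (c j) (B - mat (t j))) js) (mat 1)"
proof (induction js)
  case (Cons j js)
  have "(A - mat (t j)) ** H = H ** (B - mat (t j))"
  proof -
    have "mat (t j) ** H = H ** mat (t j)"
      by (simp add: vec_eq_iff mat_mult_nth mult_mat_nth)
    with assms show ?thesis
      by (simp add: matrix_diff_mult_left matrix_diff_mult_right)
  qed
  then have "mat_smult (c j) (A - mat (t j)) ** H = H ** mat_smult (c j) (B - mat (t j))"
    by (simp add: mat_smult_mult_left mat_smult_mult_right)
  with Cons.IH show ?case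
    by (simp add: matrix_mul_assoc [symmetric]) (simp add: matrix_mul_assoc)
qed simp

text \<open>The Lagrange polynomial of index \<open>i\<close> is 1 at its own eigenvalue and 0 at
  the others. For \<open>i\<close> above D no factor is filtered out and both sides vanish.\<close>

lemma E_star_eq_lagrange:
  "(E_star i :: ('n::finite) cmat) = foldr (**)
     (map (\<lambda>j. mat_smult (1 / (theta TYPE('n) i - theta TYPE('n) j)) (dual_adj_mat - mat (theta TYPE('n) j)))
          (filter (\<lambda>j. j \<noteq> i) [0..<Suc CARD('n)])) (mat 1)"
proof -
  have "(\<Prod>j\<leftarrow>filter (\<lambda>j. j \<noteq> i) [0..<Suc CARD('n)]. 1 / (theta TYPE('n) i - theta TYPE('n) j) *
      (theta TYPE('n) (weight y) - theta TYPE('n) j)) = (if weight y = i then 1 else 0)" for y :: "'n vertex"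
  proof (cases "weight y = i")
    case True
    have "(\<Prod>j\<leftarrow>filter (\<lambda>j. j \<noteq> i) [0..<Suc CARD('n)]. 1 / (theta TYPE('n) i - theta TYPE('n) j) *
      (theta TYPE('n) (weight y) - theta TYPE('n) j)) =
      (\<Prod>j\<leftarrow>filter (\<lambda>j. j \<noteq> i) [0..<Suc CARD('n)]. 1)"
      using True by (intro arg_cong [where f = prod_list] map_cong refl) (auto simp: theta_eq_iff simp del: upt_Suc)
    with True show ?thesis by (simp add: map_replicate_const)
  next
    case False
    then have "weight y \<in> set (filter (\<lambda>j. j \<noteq> i) [0..<Suc CARD('n)])"
      using weight_le [of y] by (auto simp del: upt_Suc)
    then have "(\<Prod>j\<leftarrow>filter (\<lambda>j. j \<noteq> i) [0..<Suc CARD('n)]. 1 / (theta TYPE('n) i - theta TYPE('n) j) *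
      (theta TYPE('n) (weight y) - theta TYPE('n) j)) = 0"
      unfolding prod_list_zero_iff set_map by (rule rev_image_eqI) (simp del: upt_Suc)
    with False show ?thesis by simp
  qed
  then show ?thesis
    unfolding lagrange_dual_adj by (simp only: vec_eq_iff vec_lambda_beta E_star_nth) auto
qed

text \<open>The Hadamard matrix turns the Lagrange polynomial in \<open>adj_mat\<close> into the one
  in \<open>dual_adj_mat\<close>; the right factor is its inverse.\<close>

lemma E_mat_eq: "(E_mat i :: ('n::finite) cmat) = kpow 1 1 1 (-1) ** E_star i ** kpow (1/2) (1/2) (1/2) (-1/2)"
proof -
  have "(E_mat i :: 'n cmat) ** kpow 1 1 1 (-1) = kpow 1 1 1 (-1) ** E_star i"
    unfolding E_mat_def E_star_eq_lagrange by (rule intertwine_foldr [OF adj_hadamard])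
  then have "(E_mat i :: 'n cmat) ** (kpow 1 1 1 (-1) ** kpow (1/2) (1/2) (1/2) (-1/2)) =
     kpow 1 1 1 (-1) ** E_star i ** kpow (1/2) (1/2) (1/2) (-1/2)"
    by (simp only: matrix_mul_assoc)
  then show ?thesis
    by (simp add: kpow_mult kpow_1)
qed

lemma matrix_inv_P_mat: "matrix_inv (P_mat :: ('n::finite) cmat) = kpow (1/2) (\<i>/2) (1/2) (-\<i>/2)"
proof -
  let ?Q = "kpow (1/2) (\<i>/2) (1/2) (-\<i>/2) :: 'n cmat"
  have Q: "P_mat ** ?Q = mat 1" "?Q ** P_mat = mat 1"
    unfolding P_mat_eq kpow_mult kpow_1 [symmetric]
    by (rule arg_cong4 [where f = kpow]; simp add: algebra_simps)+
  then have "\<exists>Q. P_mat ** Q = mat 1 \<and> Q ** P_mat = (mat 1 :: 'n cmat)"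
    by blast
  \<comment> \<open>\<open>matrix_inv\<close> is a choice among two-sided inverses, so one is
    exhibited first; multiplying by \<open>?Q\<close> from the left then identifies the chosen
    one.\<close>
  from someI_ex [OF this] have "P_mat ** matrix_inv P_mat = (mat 1 :: 'n cmat)"
    unfolding matrix_inv_def by blast
  then have "(?Q ** P_mat) ** matrix_inv P_mat = ?Q"
    unfolding matrix_mul_assoc [symmetric] by simp
  then show ?thesis
    by (simp only: Q matrix_mul_lid)
qed

text \<open>The outer factors are P^-1 H and H^-1 P, with H the Hadamard matrix. They are
  circulants, namely those of \<open>E_mat_gen\<close> at \<open>s = \<i>\<close> and
  \<open>s = -\<i>\<close>, so they will preserve every T-module.\<close>

lemma E_eps_eq:
  "(E_eps i :: ('n::finite) cmat) = kpow ((1+\<i>)/2) ((1-\<i>)/2) ((1-\<i>)/2) ((1+\<i>)/2) ** E_star i **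
     kpow ((1-\<i>)/2) ((1+\<i>)/2) ((1+\<i>)/2) ((1-\<i>)/2)"
proof -
  have "(E_eps i :: 'n cmat) = (kpow (1/2) (\<i>/2) (1/2) (-\<i>/2) ** kpow 1 1 1 (-1)) ** E_star i **
     (kpow (1/2) (1/2) (1/2) (-1/2) ** kpow 1 1 (-\<i>) \<i>)"
    by (simp only: E_eps_def matrix_inv_P_mat E_mat_eq matrix_mul_assoc) (simp only: P_mat_eq matrix_mul_assoc)
  then show ?thesis
    unfolding kpow_mult by (simp only: add_divide_distrib diff_divide_distrib) simp
qed

subsection \<open>Generating functions of the idempotents\<close>

lemma matrix_vector_mult_sum:
  fixes A :: "('n::finite) cmat"
  shows "A *v (\<Sum>i\<in>S. c i *s f i) = (\<Sum>i\<in>S. c i *s (A *v f i))"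
  by (induction S rule: infinite_finite_induct)
    (simp_all add: matrix_vector_right_distrib vector_scalar_commute)

lemma E_star_gen: "kpow 1 0 0 s *v v = (\<Sum>i\<le>CARD('n::finite). s ^ i *s ((E_star i :: 'n cmat) *v v))"
  by (simp add: kpow_diag_eq_sum_E_star)

lemma conj_E_star_gen:
  fixes B C :: "('n::finite) cmat"
  shows "(B ** kpow 1 0 0 s ** C) *v v = (\<Sum>i\<le>CARD('n). s ^ i *s ((B ** E_star i ** C) *v v))"
  by (simp add: matrix_vector_mul_assoc [symmetric] E_star_gen matrix_vector_mult_sum)

lemma E_mat_gen:
  "kpow ((1+s)/2) ((1-s)/2) ((1-s)/2) ((1+s)/2) *v v =
     (\<Sum>i\<le>CARD('n::finite). s ^ i *s ((E_mat i :: 'n cmat) *v v))"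
proof -
  have "(kpow 1 1 1 (-1) ** kpow 1 0 0 s ** kpow (1/2) (1/2) (1/2) (-1/2) :: 'n cmat) =
      kpow ((1+s)/2) ((1-s)/2) ((1-s)/2) ((1+s)/2)"
    by (simp add: kpow_mult add_divide_distrib diff_divide_distrib)
  then show ?thesis
    using conj_E_star_gen [of "kpow 1 1 1 (-1)" s "kpow (1/2) (1/2) (1/2) (-1/2)" v]
    by (simp add: E_mat_eq)
qed

lemma E_eps_gen:
  "kpow ((1+s)/2) (\<i>*(1-s)/2) (-\<i>*(1-s)/2) ((1+s)/2) *v v =
     (\<Sum>i\<le>CARD('n::finite). s ^ i *s ((E_eps i :: 'n cmat) *v v))"
proof -
  have "(kpow ((1+\<i>)/2) ((1-\<i>)/2) ((1-\<i>)/2) ((1+\<i>)/2) ** kpow 1 0 0 s **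
      kpow ((1-\<i>)/2) ((1+\<i>)/2) ((1+\<i>)/2) ((1-\<i>)/2) :: 'n cmat) =
      kpow ((1+s)/2) (\<i>*(1-s)/2) (-\<i>*(1-s)/2) ((1+s)/2)"
    unfolding kpow_mult
    by (rule arg_cong4 [where f = kpow]) (simp_all add: field_simps)
  then show ?thesis
    using conj_E_star_gen [of "kpow ((1+\<i>)/2) ((1-\<i>)/2) ((1-\<i>)/2) ((1+\<i>)/2)" s
        "kpow ((1-\<i>)/2) ((1+\<i>)/2) ((1+\<i>)/2) ((1-\<i>)/2)" v]
    by (simp only: E_eps_eq)
qed

section \<open>The Hermitian form and adjoints\<close>

lemma herm_add_left: "herm (v + v') w = herm v w + herm v' w"
  by (simp add: herm_def distrib_right sum.distrib)

lemma herm_add_right: "herm v (w + w') = herm v w + herm v w'"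
  by (simp add: herm_def distrib_left sum.distrib)

lemma herm_scale_left: "herm (c *s v) w = c * herm v w"
  by (simp add: herm_def sum_distrib_left mult.assoc)

lemma herm_scale_right: "herm v (c *s w) = cnj c * herm v w"
  by (simp add: herm_def sum_distrib_left mult_ac)

lemma herm_0_left [simp]: "herm 0 w = 0"
  by (simp add: herm_def)

lemma herm_0_right [simp]: "herm v 0 = 0"
  by (simp add: herm_def)

lemma herm_sum_left: "herm (\<Sum>i\<in>S. f i) w = (\<Sum>i\<in>S. herm (f i) w)"
  by (induction S rule: infinite_finite_induct) (simp_all add: herm_add_left)

lemma herm_sum_right: "herm v (\<Sum>i\<in>S. f i) = (\<Sum>i\<in>S. herm v (f i))"
  by (induction S rule: infinite_finite_induct) (simp_all add: herm_add_right)

lemma herm_self_eq_0_iff: "herm v v = 0 \<longleftrightarrow> v = 0"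
proof -
  have "herm v v = of_real (\<Sum>y\<in>UNIV. (cmod (v $ y))\<^sup>2)"
    by (simp add: herm_def complex_norm_square [symmetric])
  then show ?thesis
    by (simp add: sum_nonneg_eq_0_iff vec_eq_iff del: of_real_sum)
qed

lemma herm_adjoint: "herm (A *v v) w = herm v ((\<chi> y z. cnj (A $ z $ y)) *v w)"
proof -
  have "(\<Sum>y\<in>UNIV. \<Sum>z\<in>UNIV. A $ y $ z * v $ z * cnj (w $ y)) =
        (\<Sum>z\<in>UNIV. \<Sum>y\<in>UNIV. A $ y $ z * v $ z * cnj (w $ y))"
    by (rule sum.swap)
  then show ?thesis
    by (simp add: herm_def matrix_vector_mult_def sum_distrib_left sum_distrib_right mult_ac)
qed

text \<open>The adjoint of a Kronecker power is the Kronecker power of the 2 by 2 adjoint.\<close>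

lemma herm_kpow:
  fixes v w :: "('n::finite) cvec"
  shows "herm (kpow a b c e *v v) w = herm v (kpow (cnj a) (cnj c) (cnj b) (cnj e) *v w)"
proof -
  have "(\<chi> y z. cnj (kpow a b c e $ z $ y)) = (kpow (cnj a) (cnj c) (cnj b) (cnj e) :: 'n cmat)"
    by (auto simp: kpow_def vec_eq_iff entry2_def intro!: prod.cong)
  then show ?thesis
    by (simp only: herm_adjoint)
qed

lemma E_star_gen_herm:
  "herm (kpow 1 0 0 s *v v) w = (\<Sum>i\<le>CARD('n::finite). herm ((E_star i :: 'n cmat) *v v) w * s ^ i)"
  by (simp add: E_star_gen herm_sum_left herm_scale_left mult.commute)

lemma herm_gen_gen:
  fixes E F :: "nat \<Rightarrow> ('n::finite) cmat"
  assumes "\<And>s v. X s *v v = (\<Sum>i\<le>CARD('n). s ^ i *s (E i *v v))"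
    and "\<And>s v. Y s *v v = (\<Sum>i\<le>CARD('n). s ^ i *s (F i *v v))"
  shows "herm (X s *v a) (Y (cnj t) *v b) =
     (\<Sum>i\<le>CARD('n). (\<Sum>j\<le>CARD('n). herm (E i *v a) (F j *v b) * t ^ j) * s ^ i)"
proof -
  have "herm (X s *v a) (Y (cnj t) *v b) =
      (\<Sum>i\<le>CARD('n). s ^ i * herm (E i *v a) (\<Sum>j\<le>CARD('n). cnj t ^ j *s (F j *v b)))"
    by (simp only: assms herm_sum_left herm_scale_left)
  then show ?thesis
    by (simp add: herm_sum_right herm_scale_right mult.commute)
qed

subsection \<open>Modules for the subconstituent algebra\<close>

definition preserves :: "('n::finite) cmat \<Rightarrow> 'n cvec set \<Rightarrow> bool" where
  "preserves B W \<longleftrightarrow> (\<forall>w\<in>W. B *v w \<in> W)"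

lemma mat_subalgebra_preserves:
  assumes "vec.subspace W"
  shows "mat_subalgebra {B. preserves B W}"
  using assms
  by (auto simp: mat_subalgebra_def preserves_def vec.subspace_def matrix_vector_mult_add_rdistrib
      mat_smult_vec matrix_vector_mul_assoc [symmetric])

text \<open>The matrices preserving a subspace form a subalgebra, so invariance need only be tested
  on the two generators.\<close>

lemma T_module_iff:
  "T_module W \<longleftrightarrow> vec.subspace W \<and> preserves adj_mat W \<and> preserves dual_adj_mat W"
proof
  assume "T_module W"
  then show "vec.subspace W \<and> preserves adj_mat W \<and> preserves dual_adj_mat W"
    by (auto simp: T_module_def preserves_def T_alg_def intro: hull_inc)
next
  assume *: "vec.subspace W \<and> preserves adj_mat W \<and> preserves dual_adj_mat W"
  then have "T_alg \<subseteq> {B. preserves B W}"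
    unfolding T_alg_def by (intro hull_minimal mat_subalgebra_preserves) auto
  with * show "T_module W"
    by (auto simp: T_module_def preserves_def)
qed

lemma mat_subalgebra_foldr:
  fixes A :: "('n::finite) cmat"
  assumes S: "mat_subalgebra S" and A: "A \<in> S"
  shows "foldr (**) (map (\<lambda>j. mat_smult (c j) (A - mat (t j))) js) (mat 1) \<in> S"
proof (induction js)
  case Nil
  with S show ?case by (simp add: mat_subalgebra_def)
next
  case (Cons j js)
  have "A - mat (t j) = A + mat_smult (- t j) (mat 1)"
    by (simp add: vec_eq_iff mat_smult_def mat_def)
  with S A have "A - mat (t j) \<in> S"
    unfolding mat_subalgebra_def by metis
  with S Cons.IH show ?case
    by (auto simp: mat_subalgebra_def)
qed

lemma preserves_mult: "preserves A W \<Longrightarrow> preserves B W \<Longrightarrow> preserves (A ** B) W"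
  by (simp add: preserves_def matrix_vector_mul_assoc [symmetric])

lemma preserves_E_star:
  assumes "T_module W"
  shows "preserves (E_star i) W"
proof -
  have "E_star i \<in> {B. preserves B W}"
    using assms unfolding E_star_eq_lagrange T_module_iff
    by (intro mat_subalgebra_foldr mat_subalgebra_preserves) simp_all
  then show ?thesis by simp
qed

lemma preserves_E_mat:
  assumes "T_module W"
  shows "preserves (E_mat i) W"
proof -
  have "E_mat i \<in> {B. preserves B W}"
    using assms unfolding E_mat_def T_module_iff
    by (intro mat_subalgebra_foldr mat_subalgebra_preserves) simp_all
  then show ?thesis by simp
qed

lemma preserves_combination:
  fixes E :: "nat \<Rightarrow> ('n::finite) cmat"
  assumes "vec.subspace W" and "\<And>i. i \<in> S \<Longrightarrow> preserves (E i) W"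
    and B: "\<And>v. B *v v = (\<Sum>i\<in>S. c i *s (E i *v v))"
  shows "preserves B W"
  using assms(1,2) unfolding preserves_def B
  by (intro ballI vec.subspace_sum vec.subspace_scale) auto

lemma preserves_kpow_diag: "T_module W \<Longrightarrow> preserves (kpow a 0 0 e) W"
  by (rule preserves_combination [OF _ preserves_E_star kpow_diag_eq_sum_E_star]) (auto simp: T_module_iff)

lemma preserves_kpow_circ:
  "T_module W \<Longrightarrow> preserves (kpow ((1+s)/2) ((1-s)/2) ((1-s)/2) ((1+s)/2)) W"
  by (rule preserves_combination [OF _ preserves_E_mat E_mat_gen]) (auto simp: T_module_iff)

lemma preserves_kpow_hadamard:
  assumes "T_module W"
  shows "preserves (kpow 1 1 1 (-1)) W"
proof -
  \<comment> \<open>The circulant at \<open>s = \<i>\<close> has entries of equal modulus; diagonal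
    factors on both sides correct phases and scale.\<close>
  have "kpow 1 1 1 (-1) = (kpow (1-\<i>) 0 0 (\<i>*(1-\<i>)) **
      kpow ((1+\<i>)/2) ((1-\<i>)/2) ((1-\<i>)/2) ((1+\<i>)/2) ** kpow 1 0 0 \<i> :: 'a cmat)"
    unfolding kpow_mult by (rule arg_cong4 [where f = kpow]) (simp_all add: field_simps)
  then show ?thesis
    using assms by (simp only: preserves_mult preserves_kpow_diag preserves_kpow_circ)
qed

text \<open>
  The factorisation comes from annihilating the lower left entry of a product of two circulants around a
  diagonal matrix; the outer diagonal factors rescale the resulting upper right entry \<open>5/2\<close> to \<open>\<tau>\<close>.
\<close>

lemma preserves_kpow_unipotent:
  assumes "T_module W"
  shows "preserves (kpow 1 \<tau> 0 1) W"
proof (cases "\<tau> = 0")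
  case True
  then show ?thesis using preserves_kpow_diag [OF assms, of 1 1] by simp
next
  case False
  then have "kpow 1 \<tau> 0 1 = (kpow (2*\<tau>/5) 0 0 1 **
      kpow ((1+1/3)/2) ((1-1/3)/2) ((1-1/3)/2) ((1+1/3)/2) ** kpow 6 0 0 (-3/2) **
      kpow ((1+(-1/3))/2) ((1-(-1/3))/2) ((1-(-1/3))/2) ((1+(-1/3))/2) **
      kpow (5/(2*\<tau>)) 0 0 1 :: 'a cmat)"
    unfolding kpow_mult by (intro arg_cong4 [where f = kpow]) (simp_all add: field_simps)
  then show ?thesis
    using assms by (simp only: preserves_mult preserves_kpow_diag preserves_kpow_circ)
qed

subsection \<open>Lowest weight vectors\<close>

text \<open>The upper unipotent powers only move mass to vertices of smaller weight. Being fixed by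
  all of them is the group form of being killed by the lowering operator of sl_2.\<close>

definition lowest_weight :: "nat \<Rightarrow> ('n::finite) cvec \<Rightarrow> bool" where
  "lowest_weight r v \<longleftrightarrow> E_star r *v v = v \<and> (\<forall>\<tau>. kpow 1 \<tau> 0 1 *v v = v)"

text \<open>The image of \<open>v\<close> stays in \<open>W\<close>, so it has no coordinates of
  weight below \<open>r\<close>. At weight at least \<open>r\<close>, only the diagonal entry
  contributes: the other nonzero entries of the row sit at strictly larger weight, where
  \<open>v\<close> vanishes.\<close>

lemma lowest_weightI:
  fixes W :: "('n::finite) cvec set"
  assumes W: "T_module W" and low: "\<And>i w. i < r \<Longrightarrow> w \<in> W \<Longrightarrow> E_star i *v w = 0"
    and v: "v \<in> W" "E_star r *v v = v"
  shows "lowest_weight r v"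
proof -
  have supp: "v $ z = 0" if "weight z \<noteq> r" for z
    using v(2) that by (metis E_star_vec_nth)
  have "(kpow 1 \<tau> 0 1 *v v) $ y = v $ y" for \<tau> and y :: "'n vertex"
  proof (cases "weight y < r")
    case True
    have "kpow 1 \<tau> 0 1 *v v \<in> W"
      using preserves_kpow_unipotent [OF W] v(1) by (auto simp: preserves_def)
    from low [OF True this] have "(E_star (weight y) *v (kpow 1 \<tau> 0 1 *v v)) $ y = 0"
      by simp
    with True supp [of y] show ?thesis
      by (simp add: E_star_vec_nth)
  next
    case False
    have summand: "(\<Prod>k\<in>UNIV. entry2 1 \<tau> 0 1 (y k) (z k)) * v $ z = (if z = y then v $ y else 0)" for z
    proof (cases "z = y")
      case True
      have "(\<Prod>k\<in>UNIV. entry2 1 \<tau> 0 1 (y k) (y k)) = 1"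
        by (rule prod.neutral) (simp add: entry2_def)
      with True show ?thesis by simp
    next
      case neq: False
      show ?thesis
      proof (cases "\<exists>k. y k \<and> \<not> z k")
        case True
        then obtain k where "y k" "\<not> z k" by auto
        then have "(\<Prod>k\<in>UNIV. entry2 1 \<tau> 0 1 (y k) (z k)) = 0"
          by (intro prod_zero) (auto simp: entry2_def intro!: bexI [of _ k])
        with neq show ?thesis by simp
      next
        case sub: False
        with neq have "{k. y k} \<subset> {k. z k}" by (auto simp: fun_eq_iff)
        then have "weight y < weight z"
          unfolding weight_def by (intro psubset_card_mono) auto
        with \<open>\<not> weight y < r\<close> neq show ?thesis by (simp add: supp)
      qed
    qed
    show ?thesis
      by (simp add: matrix_vector_mult_def kpow_def summand)
  qed
  with v(2) show ?thesis
    by (simp add: lowest_weight_def vec_eq_iff)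
qed

lemma lowest_weight_diag:
  assumes "lowest_weight r (v :: ('n::finite) cvec)"
  shows "kpow a 0 0 e *v v = (a ^ (CARD('n) - r) * e ^ r) *s v"
proof -
  have "v $ z = 0" if "weight z \<noteq> r" for z
    using assms that unfolding lowest_weight_def by (metis E_star_vec_nth)
  then have "(kpow a 0 0 e *v v) $ y = (a ^ (CARD('n) - r) * e ^ r) * v $ y" for y
    by (cases "weight y = r") (simp_all add: kpow_diag_vec_nth)
  then show ?thesis
    by (simp add: vec_eq_iff)
qed

lemma continuous_herm_kpow: "isCont (\<lambda>a. herm (kpow a b c e *v v) w) x"
proof -
  have "isCont (\<lambda>a. entry2 a b c e p q) x" for p q
    by (cases p; cases q) (simp_all add: entry2_def)
  then show ?thesis
    unfolding herm_def matrix_vector_mult_def kpow_def vec_lambda_beta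
    by (intro continuous_intros)
qed

text \<open>
  For \<open>a \<noteq> 0\<close> this follows from the LDU decomposition: the lower factor is moved to the other side as
  an upper unipotent and fixes \<open>w\<close>. Continuity in \<open>a\<close> covers \<open>a = 0\<close>.
\<close>

lemma herm_kpow_lowest_weight:
  fixes v w :: "('n::finite) cvec"
  assumes v: "lowest_weight r v" and w: "lowest_weight r w" and r: "2 * r \<le> CARD('n)"
  shows "herm (kpow a b c e *v v) w = a ^ (CARD('n) - 2 * r) * (a * e - b * c) ^ r * herm v w"
proof -
  let ?f = "\<lambda>a. herm (kpow a b c e *v v) w"
  let ?g = "\<lambda>a. a ^ (CARD('n) - 2 * r) * (a * e - b * c) ^ r * herm v w"
  have eq: "?f a = ?g a" if "a \<noteq> 0" for a
  proof -
    have "kpow a b c e = (kpow 1 0 (c/a) 1 ** kpow a 0 0 ((a*e-b*c)/a) ** kpow 1 (b/a) 0 1 :: 'n cmat)"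
      unfolding kpow_mult using that by (intro arg_cong4 [where f = kpow]) (simp_all add: field_simps)
    then have "?f a = herm (kpow 1 0 (c/a) 1 *v (kpow a 0 0 ((a*e-b*c)/a) *v v)) w"
      using v by (simp add: matrix_vector_mul_assoc [symmetric] lowest_weight_def)
    also have "\<dots> = a ^ (CARD('n) - r) * ((a*e-b*c)/a) ^ r * herm v w"
      using w by (simp add: herm_kpow lowest_weight_diag [OF v] vector_scalar_commute
          herm_scale_left lowest_weight_def)
    \<comment> \<open>The split-off \<open>a ^ r\<close>, available since \<open>2 * r\<close> is at
      most D, cancels the denominator of the determinant factor.\<close>
    also have "a ^ (CARD('n) - r) = a ^ (CARD('n) - 2 * r) * a ^ r"
      using r by (simp flip: power_add)
    finally show ?thesis
      using that by (simp add: power_divide)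
  qed
  show ?thesis
  proof (cases "a = 0")
    case True
    have "?f \<midarrow>0\<rightarrow> ?f 0"
      using continuous_herm_kpow unfolding isCont_def .
    moreover have "?g \<midarrow>0\<rightarrow> ?g 0"
      by (intro tendsto_intros)
    then have "?f \<midarrow>0\<rightarrow> ?g 0"
      by (rule Lim_transform_eventually) (auto simp: eventually_at_filter eq)
    ultimately have "?f 0 = ?g 0"
      by (rule LIM_unique)
    with True show ?thesis by simp
  qed (rule eq)
qed

subsection \<open>Krawtchouk coefficients\<close>

lemma pochhammer_neg_of_nat:
  "pochhammer (- of_nat m) n = ((-1) ^ n * fact n * of_nat (m choose n) :: complex)"
proof -
  have "of_nat (m choose n) = (-1) ^ n * pochhammer (- of_nat m) n / (fact n :: complex)"
    by (simp add: binomial_gbinomial gbinomial_pochhammer)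
  then have "(-1) ^ n * fact n * of_nat (m choose n) =
      ((-1) ^ n * (-1) ^ n) * (pochhammer (- of_nat m) n :: complex)"
    by simp
  also have "(-1) ^ n * (-1) ^ n = (1::complex)"
    by (simp flip: power_mult_distrib)
  finally show ?thesis by simp
qed

text \<open>The identity C(d,i) C(i,n) = C(d,n) C(d-n,i-n) removes the denominator
  \<open>pochhammer (- of_nat d) n\<close>.\<close>

lemma binomial_hyp2F1:
  assumes "i \<le> d"
  shows "of_nat (d choose i) * hyp2F1_upto d (- of_nat i) (- of_nat j) (- of_nat d) 2 =
     (\<Sum>n\<le>d. if n \<le> i then (-2) ^ n * of_nat (j choose n) * of_nat ((d - n) choose (i - n)) else 0)"
proof -
  have "of_nat (d choose i) * (pochhammer (- of_nat i) n * pochhammer (- of_nat j) n /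
      (pochhammer (- of_nat d) n * fact n) * 2 ^ n) =
     (if n \<le> i then (-2) ^ n * of_nat (j choose n) * of_nat ((d - n) choose (i - n)) else (0::complex))"
    if "n \<le> d" for n
  proof (cases "n \<le> i")
    case True
    have "(d choose i) * (i choose n) = (d choose n) * ((d - n) choose (i - n))"
      using True assms by (rule choose_mult)
    then have "of_nat (d choose i) * (of_nat (i choose n) :: complex) =
        of_nat (d choose n) * of_nat ((d - n) choose (i - n))"
      by (metis of_nat_mult)
    moreover have "(of_nat (d choose n) :: complex) \<noteq> 0"
      using that by (simp add: binomial_eq_0_iff)
    ultimately have eq: "of_nat (d choose i) * of_nat (i choose n) / of_nat (d choose n) =
        (of_nat ((d - n) choose (i - n)) :: complex)"
      by (simp add: field_simps)
    have "of_nat (d choose i) * (pochhammer (- of_nat i) n * pochhammer (- of_nat j) n /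
      (pochhammer (- of_nat d) n * fact n) * 2 ^ n) =
      of_nat (d choose i) * of_nat (i choose n) / of_nat (d choose n) *
        ((-1) ^ n * 2 ^ n * (of_nat (j choose n) :: complex))"
      by (simp add: pochhammer_neg_of_nat)
    with True show ?thesis
      unfolding eq by (simp add: mult_ac flip: power_mult_distrib)
  qed (simp add: pochhammer_neg_of_nat binomial_eq_0)
  then show ?thesis
    by (simp add: hyp2F1_upto_def sum_distrib_left atLeast0AtMost)
qed

text \<open>Pads a shifted polynomial with zero coefficients up to a common degree bound, ready for
  comparing coefficients.\<close>

lemma sum_shift_power:
  fixes f :: "nat \<Rightarrow> complex"
  assumes "n + m \<le> N"
  shows "s ^ n * (\<Sum>k\<le>m. f k * s ^ k) =
     (\<Sum>i\<le>N. (if n \<le> i \<and> i \<le> n + m then f (i - n) else 0) * s ^ i)"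
proof -
  have "s ^ n * (\<Sum>k\<le>m. f k * s ^ k) = (\<Sum>k\<in>{..m}. f k * s ^ (n + k))"
    by (simp add: sum_distrib_left power_add mult_ac)
  also have "\<dots> = (\<Sum>i\<in>{n..n+m}. f (i - n) * s ^ i)"
    by (rule sum.reindex_bij_witness [of _ "\<lambda>i. i - n" "\<lambda>k. n + k"]) auto
  also have "\<dots> = (\<Sum>i\<le>N. (if n \<le> i \<and> i \<le> n + m then f (i - n) else 0) * s ^ i)"
    using assms by (intro sum.mono_neutral_cong_left) auto
  finally show ?thesis .
qed

text \<open>The classical generating function of the Krawtchouk polynomials, obtained by expanding
  \<open>1 - s\<close> as \<open>-2 * s + (1 + s)\<close>.\<close>

lemma krawtchouk_gen_1:
  assumes "j \<le> d"
  shows "(1 - s) ^ j * (1 + s) ^ (d - j) =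
     (\<Sum>i\<le>d. of_nat (d choose i) * hyp2F1_upto d (- of_nat i) (- of_nat j) (- of_nat d) 2 * s ^ i)"
proof -
  have "(1 - s) ^ j = (-2 * s + (1 + s)) ^ j"
    by (simp add: algebra_simps)
  also have "\<dots> = (\<Sum>n\<le>j. of_nat (j choose n) * (-2 * s) ^ n * (1 + s) ^ (j - n))"
    by (rule binomial_ring)
  finally have "(1 - s) ^ j * (1 + s) ^ (d - j) =
      (\<Sum>n\<le>j. of_nat (j choose n) * (-2 * s) ^ n * ((1 + s) ^ (j - n) * (1 + s) ^ (d - j)))"
    by (simp only: sum_distrib_right mult.assoc)
  also have "\<dots> = (\<Sum>n\<le>j. of_nat (j choose n) * (-2 * s) ^ n * (1 + s) ^ (d - n))"
    using assms by (intro sum.cong) (auto simp flip: power_add)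
  \<comment> \<open>The added terms vanish because \<open>j choose n = 0\<close> for
    \<open>n > j\<close>.\<close>
  also have "\<dots> = (\<Sum>n\<le>d. of_nat (j choose n) * (-2 * s) ^ n * (1 + s) ^ (d - n))"
    using assms by (intro sum.mono_neutral_left) (auto simp: binomial_eq_0)
  also have "\<dots> = (\<Sum>n\<le>d. \<Sum>i\<le>d. (if n \<le> i then (-2) ^ n * of_nat (j choose n) *
      of_nat ((d - n) choose (i - n)) else 0) * s ^ i)"
  proof (rule sum.cong)
    fix n assume "n \<in> {..d}"
    then have n: "n + (d - n) \<le> d" "n \<le> d" by auto
    have "(1 + s) ^ (d - n) = (\<Sum>k\<le>d - n. of_nat ((d - n) choose k) * s ^ k)"
      using binomial_ring [of s 1 "d - n"] by (simp add: add.commute)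
    moreover have "(-2 * s) ^ n = (-2) ^ n * s ^ n"
      by (rule power_mult_distrib)
    ultimately have "of_nat (j choose n) * (-2 * s) ^ n * (1 + s) ^ (d - n) =
        ((-2) ^ n * of_nat (j choose n)) * (s ^ n * (\<Sum>k\<le>d - n. of_nat ((d - n) choose k) * s ^ k))"
      by (simp only: mult_ac)
    also have "\<dots> = (\<Sum>i\<le>d. (if n \<le> i then (-2) ^ n * of_nat (j choose n) *
      of_nat ((d - n) choose (i - n)) else 0) * s ^ i)"
      unfolding sum_shift_power [OF n(1)] unfolding sum_distrib_left using n(2) by (intro sum.cong) auto
    finally show "of_nat (j choose n) * (-2 * s) ^ n * (1 + s) ^ (d - n) =
      (\<Sum>i\<le>d. (if n \<le> i then (-2) ^ n * of_nat (j choose n) *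
      of_nat ((d - n) choose (i - n)) else 0) * s ^ i)" .
  qed simp
  also have "\<dots> = (\<Sum>i\<le>d. (\<Sum>n\<le>d. (if n \<le> i then (-2) ^ n * of_nat (j choose n) *
      of_nat ((d - n) choose (i - n)) else 0)) * s ^ i)"
    by (subst sum.swap) (simp only: sum_distrib_right)
  also have "\<dots> = (\<Sum>i\<le>d. of_nat (d choose i) *
      hyp2F1_upto d (- of_nat i) (- of_nat j) (- of_nat d) 2 * s ^ i)"
    by (intro sum.cong) (auto simp: binomial_hyp2F1)
  finally show ?thesis .
qed

lemma polyfun_shifted_coeff:
  fixes a f :: "nat \<Rightarrow> complex"
  assumes "\<And>s. (\<Sum>i\<le>N. a i * s ^ i) = s ^ r * (\<Sum>k\<le>d. f k * s ^ k)"
    and "r + d \<le> N" and "k \<le> d"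
  shows "a (r + k) = f k"
proof -
  let ?b = "\<lambda>i. if r \<le> i \<and> i \<le> r + d then f (i - r) else 0"
  have "\<forall>s. (\<Sum>i\<le>N. a i * s ^ i) = (\<Sum>i\<le>N. ?b i * s ^ i)"
    using assms(1) sum_shift_power [OF assms(2)] by simp
  then have "\<forall>i\<le>N. a i = ?b i"
    by (simp only: polyfun_eq_coeffs)
  then have "a (r + k) = ?b (r + k)"
    using assms(2,3) by simp
  with assms(3) show ?thesis by simp
qed

text \<open>Coefficients are compared first in \<open>t\<close>, by the binomial theorem, and then
  in \<open>s\<close>, by \<open>krawtchouk_gen_1\<close>.\<close>

lemma krawtchouk_coeff:
  assumes "\<And>s t. (\<Sum>i\<le>N. (\<Sum>j\<le>N. g i j * t ^ j) * s ^ i) =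
      c * ((1 + s) + \<i> * t * (1 - s)) ^ d * (s * t) ^ r"
    and "r + d \<le> N" "i \<le> d" "j \<le> d"
  shows "g (r + i) (r + j) = \<i> ^ j * c * of_nat (d choose i) * of_nat (d choose j) *
       hyp2F1_upto d (- of_nat i) (- of_nat j) (- of_nat d) 2"
proof -
  have gen: "(\<Sum>i\<le>N. g i (r + j) * s ^ i) =
      s ^ r * (c * of_nat (d choose j) * \<i> ^ j * ((1 - s) ^ j * (1 + s) ^ (d - j)))" for s
  proof -
    have "(\<Sum>j\<le>N. (\<Sum>i\<le>N. g i j * s ^ i) * t ^ j) =
        t ^ r * (\<Sum>j\<le>d. (s ^ r * (c * of_nat (d choose j) * \<i> ^ j * ((1 - s) ^ j * (1 + s) ^ (d - j)))) * t ^ j)"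
      for t
    proof -
      have "(\<Sum>j\<le>N. (\<Sum>i\<le>N. g i j * s ^ i) * t ^ j) = (\<Sum>i\<le>N. (\<Sum>j\<le>N. g i j * t ^ j) * s ^ i)"
        unfolding sum_distrib_right by (subst sum.swap) (simp add: mult_ac)
      also have "\<dots> = c * ((1 + s) + \<i> * t * (1 - s)) ^ d * (s * t) ^ r"
        by (rule assms(1))
      also have "((1 + s) + \<i> * t * (1 - s)) ^ d =
          (\<Sum>j\<le>d. of_nat (d choose j) * (\<i> * t * (1 - s)) ^ j * (1 + s) ^ (d - j))"
        by (subst add.commute) (rule binomial_ring)
      finally show ?thesis
        by (simp add: sum_distrib_left sum_distrib_right power_mult_distrib mult_ac)
    qed
    from polyfun_shifted_coeff [OF this assms(2,4)] show ?thesis .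
  qed
  have "(\<Sum>i\<le>N. g i (r + j) * s ^ i) = s ^ r * (\<Sum>i\<le>d. (c * of_nat (d choose j) * \<i> ^ j *
      (of_nat (d choose i) * hyp2F1_upto d (- of_nat i) (- of_nat j) (- of_nat d) 2)) * s ^ i)" for s
    unfolding gen krawtchouk_gen_1 [OF assms(4)] by (simp only: sum_distrib_left mult.assoc)
  from polyfun_shifted_coeff [OF this assms(2,3)] show ?thesis
    by (simp add: mult_ac)
qed

subsection \<open>Structure of irreducible modules\<close>

lemma herm_commute: "herm w v = cnj (herm v w)"
  by (simp add: herm_def mult.commute)

text \<open>Moving the right-hand matrix across as its adjoint leaves a single Kronecker power; its
  upper left entry and its determinant, which is multiplicative, give the two factors.\<close>

lemma herm_kpow_kpow:
  fixes v w :: "('n::finite) cvec"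
  assumes "lowest_weight r v" "lowest_weight r w" "2 * r \<le> CARD('n)"
  shows "herm (kpow a b c e *v v) (kpow a' b' c' e' *v w) =
     (a * cnj a' + c * cnj c') ^ (CARD('n) - 2 * r) *
     ((a * e - b * c) * cnj (a' * e' - b' * c')) ^ r * herm v w"
proof -
  have "herm (kpow a b c e *v v) (kpow a' b' c' e' *v w) =
      herm (kpow (cnj a') (cnj c') (cnj b') (cnj e') *v (kpow a b c e *v v)) w"
    by (simp add: herm_kpow)
  also have "\<dots> = herm (kpow (cnj a' * a + cnj c' * c) (cnj a' * b + cnj c' * e)
      (cnj b' * a + cnj e' * c) (cnj b' * b + cnj e' * e) *v v) w"
    by (simp only: matrix_vector_mul_assoc kpow_mult)
  also have "\<dots> = (cnj a' * a + cnj c' * c) ^ (CARD('n) - 2 * r) *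
      ((cnj a' * a + cnj c' * c) * (cnj b' * b + cnj e' * e) -
       (cnj a' * b + cnj c' * e) * (cnj b' * a + cnj e' * c)) ^ r * herm v w"
    by (rule herm_kpow_lowest_weight [OF assms])
  also have "(cnj a' * a + cnj c' * c) * (cnj b' * b + cnj e' * e) -
       (cnj a' * b + cnj c' * e) * (cnj b' * a + cnj e' * c) =
      (a * e - b * c) * cnj (a' * e' - b' * c')"
    by (simp add: algebra_simps)
  also have "cnj a' * a + cnj c' * c = a * cnj a' + c * cnj c'"
    by (simp add: mult.commute)
  finally show ?thesis .
qed

lemma dual_adj_vec: "(dual_adj_mat :: ('n::finite) cmat) *v v = (\<Sum>i\<le>CARD('n). theta TYPE('n) i *s (E_star i *v v))"
proof -
  have "(dual_adj_mat *v v) $ y = theta TYPE('n) (weight y) * v $ y" for y :: "'n vertex"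
  proof -
    have "(dual_adj_mat *v v) $ y = (\<Sum>z\<in>UNIV. if y = z then theta TYPE('n) (weight y) * v $ z else 0)"
      unfolding matrix_vector_mult_def vec_lambda_beta
      by (rule sum.cong) (auto simp: dual_adj_mat_def cube_dist_base)
    then show ?thesis by simp
  qed
  moreover have "(\<Sum>i\<le>CARD('n). theta TYPE('n) i * (E_star i *v v) $ y) =
      theta TYPE('n) (weight y) * v $ y" for y
    using weight_le [of y] by (simp add: E_star_vec_nth if_distrib cong: if_cong)
  ultimately show ?thesis
    by (simp add: vec_eq_iff)
qed

lemma adj_vec: "(adj_mat :: ('n::finite) cmat) *v v = (\<Sum>i\<le>CARD('n). theta TYPE('n) i *s (E_mat i *v v))"
proof -
  have "(adj_mat :: 'n cmat) = adj_mat ** (kpow 1 1 1 (-1) ** kpow (1/2) (1/2) (1/2) (-1/2))"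
    by (simp add: kpow_mult kpow_1)
  also have "\<dots> = kpow 1 1 1 (-1) ** dual_adj_mat ** kpow (1/2) (1/2) (1/2) (-1/2)"
    by (simp only: matrix_mul_assoc adj_hadamard)
  finally have adj: "(adj_mat :: 'n cmat) = kpow 1 1 1 (-1) ** dual_adj_mat ** kpow (1/2) (1/2) (1/2) (-1/2)" .
  show ?thesis
    by (subst adj) (simp only: E_mat_eq matrix_vector_mul_assoc [symmetric] dual_adj_vec matrix_vector_mult_sum)
qed

text \<open>The part of \<open>W\<close> orthogonal to all Kronecker power images of
  \<open>v\<close>, described by equations so that their span need not be formed.\<close>

definition kpow_orth :: "('n::finite) cvec \<Rightarrow> 'n cvec set \<Rightarrow> 'n cvec set" where
  "kpow_orth v W = {x\<in>W. \<forall>a b c e. herm (kpow a b c e *v v) x = 0}"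

text \<open>The adjoint of the generating function, applied to a Kronecker power image of
  \<open>v\<close>, is again such an image. So a polynomial in \<open>t\<close> vanishes
  identically, and hence so does its coefficient of index \<open>i\<close>.\<close>

lemma preserves_kpow_orth:
  fixes E :: "nat \<Rightarrow> ('n::finite) cmat"
  assumes "preserves (E i) W" and "i \<le> CARD('n)"
    and E: "\<And>s v. kpow (a s) (b s) (c s) (e s) *v v = (\<Sum>i\<le>CARD('n). s ^ i *s (E i *v v))"
  shows "preserves (E i) (kpow_orth v W)"
proof -
  have "herm (kpow a' b' c' e' *v v) (E i *v x) = 0" if x: "x \<in> kpow_orth v W" for x a' b' c' e'
  proof -
    have "(\<Sum>j\<le>CARD('n). herm (kpow a' b' c' e' *v v) (E j *v x) * t ^ j) = 0" for t
    proof -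
      have "(\<Sum>j\<le>CARD('n). herm (kpow a' b' c' e' *v v) (E j *v x) * t ^ j) =
          herm (kpow a' b' c' e' *v v)
            (kpow (a (cnj t)) (b (cnj t)) (c (cnj t)) (e (cnj t)) *v x)"
        by (simp add: E herm_sum_right herm_scale_right mult.commute)
      also have "\<dots> = herm (kpow (cnj (a (cnj t))) (cnj (c (cnj t))) (cnj (b (cnj t)))
          (cnj (e (cnj t))) *v (kpow a' b' c' e' *v v)) x"
        by (simp add: herm_kpow)
      also have "\<dots> = 0"
        using x by (simp add: matrix_vector_mul_assoc kpow_mult kpow_orth_def)
      finally show ?thesis .
    qed
    then have "\<forall>t. (\<Sum>j\<le>CARD('n). herm (kpow a' b' c' e' *v v) (E j *v x) * t ^ j) =
        (\<Sum>j\<le>CARD('n). 0 * t ^ j)"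
      by simp
    then show ?thesis
      using assms(2) unfolding polyfun_eq_coeffs by blast
  qed
  with assms(1) show ?thesis
    by (auto simp: preserves_def kpow_orth_def)
qed

text \<open>Both generators are linear combinations of their idempotents, which preserve
  \<open>kpow_orth v W\<close>.\<close>

lemma T_module_kpow_orth:
  assumes W: "T_module (W :: ('n::finite) cvec set)"
  shows "T_module (kpow_orth v W)"
proof -
  have sub: "vec.subspace (kpow_orth v W)"
    using W unfolding T_module_iff vec.subspace_def kpow_orth_def
    by (auto simp: herm_add_right herm_scale_right)
  have "preserves (E_star i) (kpow_orth v W)" if "i \<in> {..CARD('n)}" for i
    using that by (intro preserves_kpow_orth [OF preserves_E_star [OF W] _ E_star_gen]) simp
  moreover have "preserves (E_mat i) (kpow_orth v W)" if "i \<in> {..CARD('n)}" for i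
    using that by (intro preserves_kpow_orth [OF preserves_E_mat [OF W] _ E_mat_gen]) simp
  ultimately show ?thesis
    using preserves_combination [OF sub _ dual_adj_vec] preserves_combination [OF sub _ adj_vec] sub
    unfolding T_module_iff by blast
qed

text \<open>Removing from \<open>w\<close> its projection onto \<open>v\<close> leaves a lowest
  weight vector \<open>x\<close> orthogonal to \<open>v\<close>, hence to every Kronecker power
  image of \<open>v\<close>. So \<open>x\<close> lies in the submodule \<open>kpow_orth v W\<close>,
  which misses \<open>v\<close> and is zero by irreducibility.\<close>

lemma lowest_weight_unique:
  fixes W :: "('n::finite) cvec set"
  assumes W: "irreducible_T_module W" and v: "v \<in> W" "lowest_weight r v" "v \<noteq> 0"
    and w: "w \<in> W" "lowest_weight r w" and r: "2 * r \<le> CARD('n)"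
  shows "\<exists>c. w = c *s v"
proof -
  define c where "c = herm w v / herm v v"
  define x where "x = w + (- c) *s v"
  have T: "T_module W" using W by (simp add: irreducible_T_module_def)
  have "herm x v = 0"
    using v(3) unfolding x_def herm_add_left herm_scale_left by (simp add: c_def herm_self_eq_0_iff)
  then have vx: "herm v x = 0"
    by (simp add: herm_commute [of v x])
  have "x \<in> W"
    using T v(1) w(1) unfolding T_module_iff x_def
    by (intro vec.subspace_add vec.subspace_scale) auto
  moreover have "lowest_weight r x"
    using v(2) w(2)
    unfolding lowest_weight_def x_def matrix_vector_right_distrib vector_scalar_commute by metis
  ultimately have "x \<in> kpow_orth v W"
    by (simp add: kpow_orth_def herm_kpow_lowest_weight [OF v(2) _ r] vx)
  moreover have "v \<notin> kpow_orth v W"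
  proof
    assume "v \<in> kpow_orth v W"
    then have "herm (kpow 1 0 0 1 *v v) v = 0" by (simp add: kpow_orth_def)
    with v(3) show False by (simp add: kpow_1 herm_self_eq_0_iff)
  qed
  then have "kpow_orth v W = {0}"
    using W v(1) T_module_kpow_orth [OF T, of v]
    unfolding irreducible_T_module_def by (metis (mono_tags, lifting) kpow_orth_def mem_Collect_eq subsetI)
  ultimately have "w + (- c) *s v = 0" by (simp add: x_def)
  then have "w = c *s v"
    by (simp add: vec_eq_iff add_eq_0_iff)
  then show ?thesis ..
qed

section \<open>Symmetry and shape of the support\<close>

lemma E_star_swap:
  assumes "i \<le> CARD('n::finite)"
  shows "(E_star i :: 'n cmat) *v (kpow 0 1 1 0 *v v) = kpow 0 1 1 0 *v (E_star (CARD('n) - i) *v v)"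
proof -
  \<comment> \<open>This Kronecker power is the antipodal map of the cube, which exchanges weights
    \<open>i\<close> and D - \<open>i\<close>.\<close>
  have swap: "(kpow 0 1 1 0 *v v) $ y = v $ (\<lambda>k. \<not> y k)" for v and y :: "'n vertex"
  proof -
    have "(kpow 0 1 1 0 :: 'n cmat) $ y $ z = (if z = (\<lambda>k. \<not> y k) then 1 else 0)" for z
    proof (cases "z = (\<lambda>k. \<not> y k)")
      case True
      then show ?thesis by (auto simp: kpow_def entry2_def intro!: prod.neutral)
    next
      case False
      then obtain k where "z k \<noteq> (\<not> y k)" by auto
      then have "(\<Prod>k\<in>UNIV. entry2 0 1 1 0 (y k) (z k)) = 0"
        by (intro prod_zero) (auto simp: entry2_def intro!: bexI [of _ k])
      with False show ?thesis by (simp add: kpow_def)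
    qed
    then have "(kpow 0 1 1 0 *v v) $ y = (\<Sum>z\<in>UNIV. if z = (\<lambda>k. \<not> y k) then v $ z else 0)"
      unfolding matrix_vector_mult_def vec_lambda_beta by (intro sum.cong) auto
    then show ?thesis by simp
  qed
  have "weight (\<lambda>k. \<not> y k) = CARD('n) - weight y" for y :: "'n vertex"
  proof -
    have "{k. \<not> y k} = UNIV - {k. y k}" by auto
    then show ?thesis unfolding weight_def by (simp add: card_Diff_subset)
  qed
  then have "weight (\<lambda>k. \<not> y k) = CARD('n) - i \<longleftrightarrow> weight y = i" for y :: "'n vertex"
    using assms weight_le [of y] by auto
  then show ?thesis
    by (simp add: vec_eq_iff swap E_star_vec_nth)
qed

lemma preserves_kpow_swap: "T_module W \<Longrightarrow> preserves (kpow 0 1 1 0) W"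
  using preserves_kpow_circ [of W "-1"] by simp

lemma E_star_idem: "E_star i *v (E_star i *v v) = E_star i *v v"
  by (simp add: vec_eq_iff E_star_vec_nth)

lemma mem_module_support_iff:
  fixes W :: "('n::finite) cvec set"
  assumes "T_module W"
  shows "i \<in> module_support W \<longleftrightarrow> i \<le> CARD('n) \<and> (\<exists>w\<in>W. E_star i *v w \<noteq> 0)"
proof -
  have "0 \<in> W" using assms by (simp add: T_module_iff vec.subspace_def)
  then have "mod_image (E_star i) W \<noteq> {0} \<longleftrightarrow> (\<exists>w\<in>W. E_star i *v w \<noteq> 0)"
    unfolding mod_image_def by force
  then show ?thesis by (simp add: module_support_def)
qed

lemma module_support_swap:
  fixes W :: "('n::finite) cvec set"
  assumes "T_module W" and "i \<in> module_support W"
  shows "CARD('n) - i \<in> module_support W"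
proof -
  obtain w where w: "i \<le> CARD('n)" "w \<in> W" "E_star i *v w \<noteq> 0"
    using assms by (auto simp: mem_module_support_iff)
  let ?x = "kpow 0 1 1 0 *v w"
  have swap_swap: "kpow 0 1 1 0 *v (kpow 0 1 1 0 *v v) = v" for v :: "'n cvec"
    by (simp add: matrix_vector_mul_assoc kpow_mult kpow_1)
  have "E_star (CARD('n) - i) *v ?x = kpow 0 1 1 0 *v (E_star i *v w)"
    using w(1) by (simp add: E_star_swap)
  moreover have "kpow 0 1 1 0 *v (E_star i *v w) \<noteq> 0"
    using w(3) swap_swap [of "E_star i *v w"] by auto
  moreover have "?x \<in> W"
    using preserves_kpow_swap [OF assms(1)] w(2) by (simp add: preserves_def)
  ultimately show ?thesis
    unfolding mem_module_support_iff [OF assms(1)] by (metis diff_le_self)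
qed

text \<open>Minimality of \<open>r\<close> and the antipodal symmetry bound the support; the
  Hadamard image of \<open>v\<close> shows that nothing in between is missing.\<close>

lemma module_support_eq:
  fixes W :: "('n::finite) cvec set"
  assumes W: "T_module W" and r: "module_endpoint W = r"
    and v: "v \<in> W" "E_star r *v v = v" "v \<noteq> 0"
  shows "\<And>w. w \<in> W \<Longrightarrow> E_star r *v w = w \<Longrightarrow> lowest_weight r w"
    and "2 * r \<le> CARD('n)"
    and "module_support W = {r..CARD('n) - r}"
proof -
  have fin: "finite (module_support W)" by (simp add: module_support_def)
  obtain y where "v $ y \<noteq> 0" using v(3) by (auto simp: vec_eq_iff)
  then have "weight y = r" using v(2) by (metis E_star_vec_nth)
  then have rD: "r \<le> CARD('n)" using weight_le [of y] by simp
  have rmem: "r \<in> module_support W"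
    using v rD unfolding mem_module_support_iff [OF W] by (metis (lifting))
  have min: "r \<le> i" if "i \<in> module_support W" for i
    using fin that r unfolding module_endpoint_def by (metis Min_le)
  show lw: "lowest_weight r w" if "w \<in> W" "E_star r *v w = w" for w
  proof (rule lowest_weightI [OF W _ that])
    fix i x assume "i < r" "x \<in> W"
    then show "E_star i *v x = 0"
      using min [of i] W rD by (auto simp: mem_module_support_iff)
  qed
  \<comment> \<open>By symmetry D - \<open>r\<close> lies in the support, and \<open>r\<close> is
    its minimum.\<close>
  show r2: "2 * r \<le> CARD('n)"
    using min [OF module_support_swap [OF W rmem]] rD by simp
  show "module_support W = {r..CARD('n) - r}"
  proof
    show "module_support W \<subseteq> {r..CARD('n) - r}"
    proof
      fix i assume i: "i \<in> module_support W"
      then have "i \<le> CARD('n)" by (simp add: module_support_def)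
      with min [OF i] min [OF module_support_swap [OF W i]] show "i \<in> {r..CARD('n) - r}"
        by auto
    qed
  next
    show "{r..CARD('n) - r} \<subseteq> module_support W"
    proof
      fix i assume i: "i \<in> {r..CARD('n) - r}"
      let ?d = "CARD('n) - 2 * r"
      let ?h = "kpow 1 1 1 (-1) *v v"
      have "herm (kpow 1 0 0 t *v ?h) ?h = t ^ r * (\<Sum>k\<le>?d. (4 ^ r * herm v v * of_nat (?d choose k)) * t ^ k)"
        for t
      proof -
        have "herm (kpow 1 0 0 t *v ?h) ?h = herm (kpow 1 1 t (-t) *v v) ?h"
          by (simp add: matrix_vector_mul_assoc kpow_mult)
        \<comment> \<open>The first columns (1, \<open>t\<close>) and (1, 1) give
          \<open>t + 1\<close>; the determinants \<open>-2 * t\<close> and -2 give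
          \<open>4 * t\<close>.\<close>
        also have "\<dots> = (t + 1) ^ ?d * (4 * t) ^ r * herm v v"
          by (subst herm_kpow_kpow [OF lw [OF v(1,2)] lw [OF v(1,2)] r2]) (simp add: add.commute)
        also have "(t + 1) ^ ?d = (\<Sum>k\<le>?d. of_nat (?d choose k) * t ^ k)"
          using binomial_ring [of t 1 ?d] by simp
        finally show ?thesis
          by (simp add: power_mult_distrib sum_distrib_left sum_distrib_right mult_ac)
      qed
      then have "(\<Sum>i\<le>CARD('n). herm (E_star i *v ?h) ?h * t ^ i) =
          t ^ r * (\<Sum>k\<le>?d. (4 ^ r * herm v v * of_nat (?d choose k)) * t ^ k)" for t
        by (simp only: E_star_gen_herm)
      from polyfun_shifted_coeff [OF this, of "i - r"] i r2
      have "herm (E_star i *v ?h) ?h = 4 ^ r * herm v v * of_nat (?d choose (i - r))"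
        by auto
      moreover have "i - r \<le> ?d"
        using i unfolding atLeastAtMost_iff by linarith
      then have "of_nat (?d choose (i - r)) \<noteq> (0::complex)"
        by (simp add: binomial_eq_0_iff)
      ultimately have "herm (E_star i *v ?h) ?h \<noteq> 0"
        using v(3) by (simp add: herm_self_eq_0_iff)
      then have "E_star i *v ?h \<noteq> 0" by auto
      moreover have "?h \<in> W"
        using preserves_kpow_hadamard [OF W] v(1) by (simp add: preserves_def)
      ultimately show "i \<in> module_support W"
        using i W by (auto simp: mem_module_support_iff)
    qed
  qed
qed

text \<open>The support is an interval with D - 2r + 1 elements, and the diameter is one
  less.\<close>

lemma module_diameter_eq:
  fixes W :: "('n::finite) cvec set"
  assumes "T_module W" and "module_endpoint W = r"
    and "v \<in> W" "E_star r *v v = v" "v \<noteq> 0"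
  shows "module_diameter W = CARD('n) - 2 * r"
  using module_support_eq(2,3) [OF assms] by (simp add: module_diameter_def)

subsection \<open>The inner products\<close>

text \<open>
  The hypothesis \<open>main\<close> concerns the upper left entry of the 2 by 2 matrix representing the inner product
  of the two generating functions. The conjugate of \<open>t\<close> appears because \<^const>\<open>herm\<close> is conjugate-linear
  in its second argument.
\<close>

lemma herm_krawtchouk:
  fixes v :: "('n::finite) cvec" and E F :: "nat \<Rightarrow> 'n cmat"
  assumes v: "lowest_weight r v" "2 * r \<le> CARD('n)" and d: "d = CARD('n) - 2 * r"
    and ij: "i \<le> d" "j \<le> d"
    and E: "\<And>s v. kpow (a s) (b s) (c s) (e s) *v v = (\<Sum>i\<le>CARD('n). s ^ i *s (E i *v v))"
    and F: "\<And>s v. kpow (a' s) (b' s) (c' s) (e' s) *v v = (\<Sum>i\<le>CARD('n). s ^ i *s (F i *v v))"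
    and x: "x = \<alpha> *s (kpow p1 p2 p3 p4 *v v)" and y: "y = \<beta> *s (kpow q1 q2 q3 q4 *v v)"
    and det: "\<And>s. a s * e s - b s * c s = s" "\<And>s. a' s * e' s - b' s * c' s = s"
    and main: "\<And>s t. (a s * p1 + b s * p3) * cnj (a' (cnj t) * q1 + b' (cnj t) * q3) +
        (c s * p1 + e s * p3) * cnj (c' (cnj t) * q1 + e' (cnj t) * q3) =
      (p1 * cnj q1 + p3 * cnj q3) / 2 * ((1 + s) + \<i> * t * (1 - s))"
  shows "herm (E (r + i) *v x) (F (r + j) *v y) =
     \<i> ^ j * (1 / 2 ^ d) * herm x y * of_nat (d choose i) * of_nat (d choose j) *
       hyp2F1_upto d (- of_nat i) (- of_nat j) (- of_nat d) 2"
proof -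
  let ?p = "p1 * p4 - p2 * p3" and ?q = "q1 * q4 - q2 * q3"
  have xy: "herm x y = \<alpha> * cnj \<beta> * ((p1 * cnj q1 + p3 * cnj q3) ^ d * (?p * cnj ?q) ^ r * herm v v)"
    unfolding x y herm_scale_left herm_scale_right herm_kpow_kpow [OF v(1) v(1) v(2)] d
    by (simp only: mult_ac)
  have "(\<Sum>i\<le>CARD('n). (\<Sum>j\<le>CARD('n). herm (E i *v x) (F j *v y) * t ^ j) * s ^ i) =
      (herm x y / 2 ^ d) * ((1 + s) + \<i> * t * (1 - s)) ^ d * (s * t) ^ r" for s t
  proof -
    \<comment> \<open>Multiplicativity of the 2 by 2 determinant, with the first factor of
      determinant \<open>s\<close>.\<close>
    have detE: "(a s * p1 + b s * p3) * (c s * p2 + e s * p4) - (a s * p2 + b s * p4) * (c s * p1 + e s * p3) =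
        s * ?p"
    proof -
      have "(a s * p1 + b s * p3) * (c s * p2 + e s * p4) - (a s * p2 + b s * p4) * (c s * p1 + e s * p3) =
        (a s * e s - b s * c s) * ?p" by algebra
      then show ?thesis by (simp only: det)
    qed
    have detF: "(a' s * q1 + b' s * q3) * (c' s * q2 + e' s * q4) - (a' s * q2 + b' s * q4) * (c' s * q1 + e' s * q3) =
        s * ?q" for s
    proof -
      have "(a' s * q1 + b' s * q3) * (c' s * q2 + e' s * q4) - (a' s * q2 + b' s * q4) * (c' s * q1 + e' s * q3) =
        (a' s * e' s - b' s * c' s) * ?q" by algebra
      then show ?thesis by (simp only: det)
    qed
    have "(\<Sum>i\<le>CARD('n). (\<Sum>j\<le>CARD('n). herm (E i *v x) (F j *v y) * t ^ j) * s ^ i) =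
        herm (kpow (a s) (b s) (c s) (e s) *v x)
          (kpow (a' (cnj t)) (b' (cnj t)) (c' (cnj t)) (e' (cnj t)) *v y)"
      by (rule herm_gen_gen [OF E F, symmetric])
    also have "\<dots> = \<alpha> * (cnj \<beta> *
        herm (kpow (a s * p1 + b s * p3) (a s * p2 + b s * p4) (c s * p1 + e s * p3) (c s * p2 + e s * p4) *v v)
         (kpow (a' (cnj t) * q1 + b' (cnj t) * q3) (a' (cnj t) * q2 + b' (cnj t) * q4)
           (c' (cnj t) * q1 + e' (cnj t) * q3) (c' (cnj t) * q2 + e' (cnj t) * q4) *v v))"
      unfolding x y vector_scalar_commute matrix_vector_mul_assoc kpow_mult
        herm_scale_left herm_scale_right by (rule mult.left_commute)
    also have "\<dots> = \<alpha> * cnj \<beta> * (((p1 * cnj q1 + p3 * cnj q3) / 2 * ((1 + s) + \<i> * t * (1 - s))) ^ d *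
        (s * ?p * (t * cnj ?q)) ^ r * herm v v)"
      unfolding herm_kpow_kpow [OF v(1) v(1) v(2)] main detE detF d [symmetric]
      by simp
    \<comment> \<open>By \<open>xy\<close>, the scalars, the determinants of the \<open>p\<close>
      and \<open>q\<close> matrices and the power of \<open>p1 * cnj q1 + p3 * cnj q3\<close>
      recombine into \<open>herm x y\<close>.\<close>
    also have "\<dots> = (herm x y / 2 ^ d) * ((1 + s) + \<i> * t * (1 - s)) ^ d * (s * t) ^ r"
      unfolding xy power_mult_distrib power_divide by simp
    finally show ?thesis .
  qed
  from krawtchouk_coeff [OF this _ ij] v(2) d show ?thesis
    by simp
qed

theorem theorem11p6:
  fixes W :: "(complex ^ ('n::finite \<Rightarrow> bool)) set"
    and r d i j :: nat
    and u us ue :: "complex ^ ('n \<Rightarrow> bool)"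
  assumes "irreducible_T_module W"
    and "module_endpoint W = r"
    and "module_diameter W = d"
    and "i \<le> d" and "j \<le> d"
    and "u \<in> mod_image (E_mat r) W" and "u \<noteq> 0"
    and "us \<in> mod_image (E_star r) W" and "us \<noteq> 0"
    and "ue \<in> mod_image (E_eps r) W" and "ue \<noteq> 0"
  shows
    "herm (E_mat (r + i) *v us) (E_star (r + j) *v ue) =
       \<i> ^ j * (1 / 2 ^ d) * herm us ue * of_nat (d choose i) * of_nat (d choose j) *
       hyp2F1_upto d (- of_nat i) (- of_nat j) (- of_nat d) 2 \<and>
     herm (E_star (r + i) *v ue) (E_eps (r + j) *v u) =
       \<i> ^ j * (1 / 2 ^ d) * herm ue u * of_nat (d choose i) * of_nat (d choose j) *
       hyp2F1_upto d (- of_nat i) (- of_nat j) (- of_nat d) 2 \<and>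
     herm (E_eps (r + i) *v u) (E_mat (r + j) *v us) =
       \<i> ^ j * (1 / 2 ^ d) * herm u us * of_nat (d choose i) * of_nat (d choose j) *
       hyp2F1_upto d (- of_nat i) (- of_nat j) (- of_nat d) 2"
proof -
  have W: "T_module W" using assms(1) by (simp add: irreducible_T_module_def)
  obtain w0 where w0: "w0 \<in> W" "us = E_star r *v w0"
    using assms(8) by (auto simp: mod_image_def)
  have us: "us \<in> W" "E_star r *v us = us"
    using w0 preserves_E_star [OF W] by (auto simp: preserves_def E_star_idem)
  note facts = module_support_eq [OF W assms(2) us assms(9)]
  have d: "d = CARD('n) - 2 * r"
    using module_diameter_eq [OF W assms(2) us assms(9)] assms(3) by simp
  have lw: "lowest_weight r us"
    using us by (rule facts(1))
  \<comment> \<open>One-dimensionality of the image of \<open>W\<close> under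
    \<open>E_star r\<close>; it makes \<open>u\<close> and \<open>ue\<close> explicit up to
    scalars.\<close>
  have multiple: "\<exists>c. E_star r *v x = c *s us" if "x \<in> W" for x
  proof -
    have "E_star r *v x \<in> W" using that preserves_E_star [OF W] by (auto simp: preserves_def)
    then show ?thesis
      by (intro lowest_weight_unique [OF assms(1) us(1) lw assms(9)] facts(1,2)) (auto simp: E_star_idem)
  qed
  have half: "kpow (1/2) (1/2) (1/2) (-1/2) = (kpow (1/2) 0 0 (1/2) ** kpow 1 1 1 (-1) :: 'n cmat)"
    by (simp add: kpow_mult)
  have "preserves (kpow (1/2) (1/2) (1/2) (-1/2)) W"
    unfolding half by (intro preserves_mult preserves_kpow_diag preserves_kpow_hadamard W)
  moreover obtain w1 where "w1 \<in> W" "u = E_mat r *v w1"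
    using assms(6) by (auto simp: mod_image_def)
  ultimately obtain \<alpha> where "u = kpow 1 1 1 (-1) *v (\<alpha> *s us)"
    using multiple [of "kpow (1/2) (1/2) (1/2) (-1/2) *v w1"]
    by (auto simp: preserves_def E_mat_eq matrix_vector_mul_assoc [symmetric])
  then have u: "u = \<alpha> *s (kpow 1 1 1 (-1) *v us)"
    by (simp add: vector_scalar_commute)
  \<comment> \<open>The right factor in \<open>E_eps_eq\<close> is the circulant at
    \<open>s = -\<i>\<close>.\<close>
  have "preserves (kpow ((1-\<i>)/2) ((1+\<i>)/2) ((1+\<i>)/2) ((1-\<i>)/2)) W"
    using preserves_kpow_circ [OF W, of "-\<i>"] by simp
  moreover obtain w2 where "w2 \<in> W" "ue = E_eps r *v w2"
    using assms(10) by (auto simp: mod_image_def)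
  ultimately obtain \<beta> where "ue = kpow ((1+\<i>)/2) ((1-\<i>)/2) ((1-\<i>)/2) ((1+\<i>)/2) *v (\<beta> *s us)"
    using multiple [of "kpow ((1-\<i>)/2) ((1+\<i>)/2) ((1+\<i>)/2) ((1-\<i>)/2) *v w2"]
    by (auto simp: preserves_def E_eps_eq matrix_vector_mul_assoc [symmetric])
  then have ue: "ue = \<beta> *s (kpow ((1+\<i>)/2) ((1-\<i>)/2) ((1-\<i>)/2) ((1+\<i>)/2) *v us)"
    by (simp add: vector_scalar_commute)
  \<comment> \<open>The identity as a Kronecker power gives \<open>us\<close> the form that
    \<open>herm_krawtchouk\<close> expects.\<close>
  have us': "us = 1 *s (kpow 1 0 0 1 *v us)"
    by (simp add: kpow_1)
  note krawtchouk = herm_krawtchouk [OF lw facts(2) d assms(4,5)]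
  show ?thesis
  proof (intro conjI)
    show "herm (E_mat (r + i) *v us) (E_star (r + j) *v ue) =
       \<i> ^ j * (1 / 2 ^ d) * herm us ue * of_nat (d choose i) * of_nat (d choose j) *
       hyp2F1_upto d (- of_nat i) (- of_nat j) (- of_nat d) 2"
      \<comment> \<open>What remains here and in the next two cases are the two determinants and the
        2 by 2 identity \<open>main\<close>.\<close>
      by (rule krawtchouk [OF E_mat_gen E_star_gen us' ue]) (simp_all add: field_simps)
    show "herm (E_star (r + i) *v ue) (E_eps (r + j) *v u) =
       \<i> ^ j * (1 / 2 ^ d) * herm ue u * of_nat (d choose i) * of_nat (d choose j) *
       hyp2F1_upto d (- of_nat i) (- of_nat j) (- of_nat d) 2"
      by (rule krawtchouk [OF E_star_gen E_eps_gen ue u]) (simp_all add: field_simps)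
    show "herm (E_eps (r + i) *v u) (E_mat (r + j) *v us) =
       \<i> ^ j * (1 / 2 ^ d) * herm u us * of_nat (d choose i) * of_nat (d choose j) *
       hyp2F1_upto d (- of_nat i) (- of_nat j) (- of_nat d) 2"
      by (rule krawtchouk [OF E_eps_gen E_mat_gen u us']) (simp_all add: field_simps)
  qed
qed

end
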